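(* Let $\mathfrak g$ be the Lie algebra of a Lie group $G$, and let $(\Lambda,E)$ be the Jacobi structure on $\mathfrak g^*\times\mathbb R$ given by $$\Lambda(\mu,z)(df,dg)=\left\langle\mu,\left[\frac{\delta f}{\delta\mu},\frac{\delta g}{\delta\mu}\right]\right\rangle+\left\langle\mu,\frac{\delta f}{\delta\mu}\right\rangle\frac{\partial g}{\partial z}-\left\langle\mu,\frac{\delta g}{\delta\mu}\right\rangle\frac{\partial f}{\partial z},\qquad E=-\frac{\partial}{\partial z}.$$ If $h:\mathfrak g^*\times\mathbb R\to\mathbb R$ is a (smooth) reduced Hamiltonian function, then the integral curves $(\mu(t),z(t))$ of the Hamiltonian vector field $X_h$ satisfy the Lie-Poisson-Jacobi equations $$\dot\mu=\operatorname{ad}^*_{\frac{\delta h}{\delta\mu}}\mu-\mu\frac{\partial h}{\partial z},\qquad\dot z=\left\langle\mu,\frac{\delta h}{\delta\mu}\right\rangle-h(\mu,z).$$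
   Context: $\frac{\delta f}{\delta\mu}(\mu,z)\in\mathfrak g^{**}\cong\mathfrak g$ is the partial derivative of $f$ with respect to $\mu\in\mathfrak g^*$. $\operatorname{ad}^*_\xi$ is the dual of $\operatorname{ad}_\xi=[\xi,\cdot]$: $\langle\operatorname{ad}^*_\xi\mu,\eta\rangle=\langle\mu,[\xi,\eta]\rangle$. For a Jacobi manifold $(M,\Lambda,E)$, the Hamiltonian vector field of $f\in C^\infty(M)$ is $X_f=\sharp_\Lambda(df)+fE$, where $\sharp_\Lambda(\alpha)=\Lambda(\alpha,\cdot)$. *)

theory Defs
  imports "HOL-Analysis.Analysis"
begin

text \<open>A finite-dimensional real Lie algebra, carried by the type \<open>'g\<close>. The inner product that
  comes with the class \<^class>\<open>euclidean_space\<close> is never used. The Lie algebra of a Lie group is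
  of this kind, and by Lie's third theorem every such algebra arises in this way.\<close>

definition lie_algebra :: "('g::euclidean_space \<Rightarrow> 'g \<Rightarrow> 'g) \<Rightarrow> bool" where
  "lie_algebra br \<longleftrightarrow> bilinear br \<and> (\<forall>x. br x x = 0) \<and>
     (\<forall>x y w. br x (br y w) + br y (br w x) + br w (br x y) = 0)"

definition ad :: "('g::euclidean_space \<Rightarrow> 'g \<Rightarrow> 'g) \<Rightarrow> 'g \<Rightarrow> 'g \<Rightarrow>\<^sub>L 'g" where
  "ad br \<xi> = Blinfun (br \<xi>)"

definition ad_star ::
  "('g::euclidean_space \<Rightarrow> 'g \<Rightarrow> 'g) \<Rightarrow> 'g \<Rightarrow> ('g \<Rightarrow>\<^sub>L real) \<Rightarrow> ('g \<Rightarrow>\<^sub>L real)" where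
  "ad_star br \<xi> \<mu> = \<mu> o\<^sub>L ad br \<xi>"

text \<open>On a finite-dimensional domain (the only case used below) a function is \<open>k + 1\<close> times
  continuously differentiable iff it is differentiable and each directional derivative is \<open>k\<close>
  times continuously differentiable. Using directional derivatives keeps the recursion inside
  one type.\<close>

primrec Ck :: "nat \<Rightarrow> ('v::real_normed_vector \<Rightarrow> real) \<Rightarrow> bool" where
  "Ck 0 f \<longleftrightarrow> continuous_on UNIV f"
| "Ck (Suc k) f \<longleftrightarrow> (\<forall>x. f differentiable (at x)) \<and>
     (\<forall>v. Ck k (\<lambda>x. frechet_derivative f (at x) v))"

definition smooth :: "('v::real_normed_vector \<Rightarrow> real) \<Rightarrow> bool" where
  "smooth f \<longleftrightarrow> (\<forall>k. Ck k f)"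

text \<open>The inverse of the canonical embedding \<open>v \<mapsto> (\<alpha> \<mapsto> \<alpha> v)\<close> of \<open>V\<close> into \<open>V\<^sup>*\<^sup>*\<close>, i.e. the
  identification of \<open>V\<^sup>*\<^sup>*\<close> with \<open>V\<close> for finite-dimensional \<open>V\<close>.\<close>

definition from_bidual :: "(('v::real_normed_vector \<Rightarrow>\<^sub>L real) \<Rightarrow> real) \<Rightarrow> 'v" where
  "from_bidual \<phi> = (THE v. \<forall>\<alpha>. \<phi> \<alpha> = blinfun_apply \<alpha> v)"

definition differential :: "('v::real_normed_vector \<Rightarrow> real) \<Rightarrow> 'v \<Rightarrow> ('v \<Rightarrow>\<^sub>L real)" where
  "differential f p = Blinfun (frechet_derivative f (at p))"

text \<open>Vector fields and bivector fields on a vector space \<open>V\<close>: all tangent spaces are \<open>V\<close> and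
  all cotangent spaces are \<open>V\<^sup>*\<close>, so a bivector at a point is a form on \<open>V\<^sup>*\<close>.\<close>

type_synonym 'v bivector_field = "'v \<Rightarrow> ('v \<Rightarrow>\<^sub>L real) \<Rightarrow> ('v \<Rightarrow>\<^sub>L real) \<Rightarrow> real"

definition sharp ::
  "'v::real_normed_vector bivector_field \<Rightarrow> 'v \<Rightarrow> ('v \<Rightarrow>\<^sub>L real) \<Rightarrow> 'v" where
  "sharp \<Lambda> p \<alpha> = from_bidual (\<lambda>\<beta>. \<Lambda> p \<alpha> \<beta>)"

definition hamiltonian_vector_field ::
  "'v::real_normed_vector bivector_field \<Rightarrow> ('v \<Rightarrow> 'v) \<Rightarrow> ('v \<Rightarrow> real) \<Rightarrow> 'v \<Rightarrow> 'v" where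
  "hamiltonian_vector_field \<Lambda> E f p = sharp \<Lambda> p (differential f p) + f p *\<^sub>R E p"

definition integral_curve ::
  "('v::real_normed_vector \<Rightarrow> 'v) \<Rightarrow> real set \<Rightarrow> (real \<Rightarrow> 'v) \<Rightarrow> bool" where
  "integral_curve X I \<gamma> \<longleftrightarrow> open I \<and> is_interval I \<and>
     (\<forall>t\<in>I. (\<gamma> has_vector_derivative X (\<gamma> t)) (at t))"

definition delta_mu :: "(('g::euclidean_space \<Rightarrow>\<^sub>L real) \<times> real \<Rightarrow> real) \<Rightarrow>
    ('g \<Rightarrow>\<^sub>L real) \<times> real \<Rightarrow> 'g" where
  "delta_mu f p = from_bidual (frechet_derivative (\<lambda>\<nu>. f (\<nu>, snd p)) (at (fst p)))"

definition partial_z :: "(('g::euclidean_space \<Rightarrow>\<^sub>L real) \<times> real \<Rightarrow> real) \<Rightarrow>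
    ('g \<Rightarrow>\<^sub>L real) \<times> real \<Rightarrow> real" where
  "partial_z f p = deriv (\<lambda>s. f (fst p, s)) (snd p)"

text \<open>The two components of a covector \<open>\<alpha>\<close> on \<open>\<gg>\<^sup>* \<times> \<real>\<close>; for \<open>\<alpha> = df\<close> they are the two partial
  derivatives of \<open>f\<close>, and the usual formula for \<open>\<Lambda>(df, dg)\<close> is the lemma
  \<open>LPJ_bivector_differential\<close>.\<close>

definition cov_mu :: "(('g::euclidean_space \<Rightarrow>\<^sub>L real) \<times> real) \<Rightarrow>\<^sub>L real \<Rightarrow> 'g" where
  "cov_mu \<alpha> = from_bidual (\<lambda>\<nu>. blinfun_apply \<alpha> (\<nu>, 0))"

definition cov_z :: "(('g::euclidean_space \<Rightarrow>\<^sub>L real) \<times> real) \<Rightarrow>\<^sub>L real \<Rightarrow> real" where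
  "cov_z \<alpha> = blinfun_apply \<alpha> (0, 1)"

definition LPJ_bivector :: "('g::euclidean_space \<Rightarrow> 'g \<Rightarrow> 'g) \<Rightarrow>
    (('g \<Rightarrow>\<^sub>L real) \<times> real) bivector_field" where
  "LPJ_bivector br p \<alpha> \<beta> =
     blinfun_apply (fst p) (br (cov_mu \<alpha>) (cov_mu \<beta>))
     + blinfun_apply (fst p) (cov_mu \<alpha>) * cov_z \<beta>
     - blinfun_apply (fst p) (cov_mu \<beta>) * cov_z \<alpha>"

definition LPJ_vector :: "(('g::euclidean_space \<Rightarrow>\<^sub>L real) \<times> real) \<Rightarrow> (('g \<Rightarrow>\<^sub>L real) \<times> real)" where
  "LPJ_vector p = (0, -1)"

lemma blinfun_apply_differential:
  assumes "f differentiable (at p)"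
  shows "blinfun_apply (differential f p) = frechet_derivative f (at p)"
  unfolding differential_def
  using assms frechet_derivative_works has_derivative_bounded_linear
  by (blast intro: bounded_linear_Blinfun_apply)

lemma cov_mu_differential:
  assumes "f differentiable (at p)"
  shows "cov_mu (differential f p) = delta_mu f p"
proof -
  have D: "(f has_derivative frechet_derivative f (at (fst p, snd p))) (at (fst p, snd p))"
    using assms frechet_derivative_works by force
  have P: "((\<lambda>\<nu>. (\<nu>, snd p)) has_derivative (\<lambda>\<nu>. (\<nu>, 0))) (at (fst p))"
    by (auto intro!: derivative_eq_intros)
  have "((\<lambda>\<nu>. f (\<nu>, snd p)) has_derivative (\<lambda>\<nu>. frechet_derivative f (at p) (\<nu>, 0))) (at (fst p))"
    using has_derivative_compose[OF P D] by simp
  then have "frechet_derivative (\<lambda>\<nu>. f (\<nu>, snd p)) (at (fst p)) =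
      (\<lambda>\<nu>. frechet_derivative f (at p) (\<nu>, 0))"
    using frechet_derivative_at by metis
  then show ?thesis
    by (simp add: cov_mu_def delta_mu_def blinfun_apply_differential[OF assms])
qed

lemma cov_z_differential:
  assumes "f differentiable (at p)"
  shows "cov_z (differential f p) = partial_z f p"
proof -
  have D: "(f has_derivative frechet_derivative f (at (fst p, snd p))) (at (fst p, snd p))"
    using assms frechet_derivative_works by force
  have P: "((\<lambda>s. (fst p, s)) has_derivative (\<lambda>s. (0, s))) (at (snd p))"
    by (auto intro!: derivative_eq_intros)
  have 1: "((\<lambda>s. f (fst p, s)) has_derivative (\<lambda>s. frechet_derivative f (at p) (0, s))) (at (snd p))"
    using has_derivative_compose[OF P D] by simp
  have 2: "(\<lambda>s. frechet_derivative f (at p) (0, s)) = (*) (frechet_derivative f (at p) (0, 1))"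
  proof
    fix s
    show "frechet_derivative f (at p) (0, s) = frechet_derivative f (at p) (0, 1) * s"
      using linear_cmul[OF has_derivative_linear[OF 1], of s 1]
      by (simp only: real_scaleR_def mult_1_left mult_1_right mult.commute)
  qed
  have "((\<lambda>s. f (fst p, s)) has_real_derivative frechet_derivative f (at p) (0, 1)) (at (snd p))"
    using 1 unfolding 2 has_field_derivative_def .
  then show ?thesis
    by (simp add: cov_z_def partial_z_def blinfun_apply_differential[OF assms] DERIV_imp_deriv)
qed

lemma LPJ_bivector_differential:
  assumes "f differentiable (at (\<mu>, z))" and "g differentiable (at (\<mu>, z))"
  shows "LPJ_bivector br (\<mu>, z) (differential f (\<mu>, z)) (differential g (\<mu>, z)) =
     blinfun_apply \<mu> (br (delta_mu f (\<mu>, z)) (delta_mu g (\<mu>, z)))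
     + blinfun_apply \<mu> (delta_mu f (\<mu>, z)) * partial_z g (\<mu>, z)
     - blinfun_apply \<mu> (delta_mu g (\<mu>, z)) * partial_z f (\<mu>, z)"
  using assms by (simp add: LPJ_bivector_def cov_mu_differential cov_z_differential)

text \<open>The description in \<open>from_bidual\<close> always has a unique solution in the two cases where it is
  used, \<open>V = \<gg>\<close> and \<open>V = \<gg>\<^sup>* \<times> \<real>\<close>.\<close>

lemma linear_dual_rep:
  fixes \<phi> :: "('g::euclidean_space \<Rightarrow>\<^sub>L real) \<Rightarrow> real"
  assumes "linear \<phi>"
  shows "\<exists>!v. \<forall>\<alpha>. \<phi> \<alpha> = blinfun_apply \<alpha> v"
proof
  let ?v = "\<Sum>b\<in>Basis. \<phi> (blinfun_inner_left b) *\<^sub>R b"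
  show "\<forall>\<alpha>. \<phi> \<alpha> = blinfun_apply \<alpha> ?v"
  proof
    fix \<alpha> :: "'g \<Rightarrow>\<^sub>L real"
    have "\<alpha> = (\<Sum>b\<in>Basis. blinfun_apply \<alpha> b *\<^sub>R blinfun_inner_left b)"
      (is "_ = ?s")
    proof (rule blinfun_eqI)
      fix x
      have "blinfun_apply \<alpha> x = blinfun_apply \<alpha> (\<Sum>b\<in>Basis. (x \<bullet> b) *\<^sub>R b)"
        by (simp add: euclidean_representation)
      then show "blinfun_apply \<alpha> x = blinfun_apply ?s x"
        by (simp add: blinfun.sum_left blinfun.sum_right blinfun.scaleR_left
            blinfun.scaleR_right mult.commute inner_commute)
    qed
    then have "\<phi> \<alpha> = \<phi> ?s" by (rule arg_cong)
    also have "\<dots> = blinfun_apply \<alpha> ?v"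
      by (simp add: linear_sum[OF assms] linear_cmul[OF assms] blinfun.sum_right
          blinfun.scaleR_right mult.commute)
    finally show "\<phi> \<alpha> = blinfun_apply \<alpha> ?v" .
  qed
next
  fix v assume v: "\<forall>\<alpha>. \<phi> \<alpha> = blinfun_apply \<alpha> v"
  show "v = (\<Sum>b\<in>Basis. \<phi> (blinfun_inner_left b) *\<^sub>R b)"
  proof -
    have "\<phi> (blinfun_inner_left b) = v \<bullet> b" for b
      using v by (simp add: inner_commute)
    then show ?thesis by (simp only: euclidean_representation)
  qed
qed

lemma linear_dual_rep_prod:
  fixes \<phi> :: "((('g::euclidean_space \<Rightarrow>\<^sub>L real) \<times> real) \<Rightarrow>\<^sub>L real) \<Rightarrow> real"
  assumes "linear \<phi>"
  shows "\<exists>!v. \<forall>\<alpha>. \<phi> \<alpha> = blinfun_apply \<alpha> v"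
proof -
  define ev where "ev = (\<lambda>\<xi>::'g. Blinfun (\<lambda>p::('g \<Rightarrow>\<^sub>L real) \<times> real. blinfun_apply (fst p) \<xi>))"
  let ?snd = "Blinfun (snd :: ('g \<Rightarrow>\<^sub>L real) \<times> real \<Rightarrow> real)"
  have bl: "bounded_linear (\<lambda>p::('g \<Rightarrow>\<^sub>L real) \<times> real. blinfun_apply (fst p) \<xi>)" for \<xi>
    by (intro bounded_linear_intros)
  have ev_apply: "blinfun_apply (ev \<xi>) p = blinfun_apply (fst p) \<xi>" for \<xi> p
    by (simp add: ev_def bounded_linear_Blinfun_apply[OF bl])
  have sn: "blinfun_apply ?snd p = snd p" for p
    by (simp add: bounded_linear_Blinfun_apply bounded_linear_snd)
  have lin_ev: "linear (\<lambda>\<xi>. \<phi> (ev \<xi>))"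
  proof (rule linearI)
    fix x y :: 'g and r :: real
    have "ev (x + y) = ev x + ev y"
      by (rule blinfun_eqI) (simp only: ev_apply blinfun.add_left blinfun.add_right)
    then show "\<phi> (ev (x + y)) = \<phi> (ev x) + \<phi> (ev y)"
      by (simp add: linear_add[OF assms])
    have "ev (r *\<^sub>R x) = r *\<^sub>R ev x"
      by (rule blinfun_eqI) (simp only: ev_apply blinfun.scaleR_left blinfun.scaleR_right)
    then show "\<phi> (ev (r *\<^sub>R x)) = r *\<^sub>R \<phi> (ev x)"
      by (simp add: linear_cmul[OF assms])
  qed
  define \<psi> where "\<psi> = Blinfun (\<lambda>\<xi>. \<phi> (ev \<xi>))"
  have psi: "blinfun_apply \<psi> \<xi> = \<phi> (ev \<xi>)" for \<xi>
    using lin_ev by (simp add: \<psi>_def bounded_linear_Blinfun_apply linear_conv_bounded_linear)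
  have ex: "\<phi> \<alpha> = blinfun_apply \<alpha> (\<psi>, \<phi> ?snd)" for \<alpha>
  proof -
    have "linear (\<lambda>\<nu>::'g \<Rightarrow>\<^sub>L real. (\<nu>, 0::real))" by (rule linearI) auto
    from linear_compose[OF this, of "blinfun_apply \<alpha>"]
    have "linear (\<lambda>\<nu>. blinfun_apply \<alpha> (\<nu>, 0))"
      by (simp add: o_def blinfun.bounded_linear_right bounded_linear.linear)
    from linear_dual_rep[OF this] obtain \<xi>
      where xi: "\<And>\<nu>. blinfun_apply \<alpha> (\<nu>, 0) = blinfun_apply \<nu> \<xi>" by blast
    have split: "blinfun_apply \<alpha> (\<nu>, s) = blinfun_apply \<nu> \<xi> + s * blinfun_apply \<alpha> (0, 1)" for \<nu> s
    proof -
      have "blinfun_apply \<alpha> (\<nu>, s) = blinfun_apply \<alpha> ((\<nu>, 0) + s *\<^sub>R (0, 1))" by simp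
      then show ?thesis unfolding blinfun.add_right blinfun.scaleR_right by (simp add: xi)
    qed
    have "\<alpha> = ev \<xi> + blinfun_apply \<alpha> (0, 1) *\<^sub>R ?snd"
    proof (rule blinfun_eqI)
      fix p
      show "blinfun_apply \<alpha> p = blinfun_apply (ev \<xi> + blinfun_apply \<alpha> (0, 1) *\<^sub>R ?snd) p"
        using split[of "fst p" "snd p"]
        by (simp add: ev_apply sn blinfun.add_left blinfun.scaleR_left mult.commute)
    qed
    then have "\<phi> \<alpha> = \<phi> (ev \<xi>) + blinfun_apply \<alpha> (0, 1) * \<phi> ?snd"
      by (metis linear_add[OF assms] linear_cmul[OF assms] real_scaleR_def)
    then show ?thesis using split[of \<psi> "\<phi> ?snd"] by (simp add: psi mult.commute)
  qed
  have "v = w" if "\<forall>\<alpha>. \<phi> \<alpha> = blinfun_apply \<alpha> v" and "\<forall>\<alpha>. \<phi> \<alpha> = blinfun_apply \<alpha> w" for v w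
  proof (rule prod_eqI)
    have eq: "blinfun_apply \<alpha> v = blinfun_apply \<alpha> w"
      for \<alpha> :: "(('g \<Rightarrow>\<^sub>L real) \<times> real) \<Rightarrow>\<^sub>L real"
      using that by metis
    show "fst v = fst w" by (rule blinfun_eqI) (use eq[of "ev _"] in \<open>simp add: ev_apply\<close>)
    show "snd v = snd w" using eq[of ?snd] by (simp add: sn)
  qed
  with ex show ?thesis by blast
qed

end

theory Submission
  imports Defs
begin

text \<open>The claim is pointwise: compute \<open>X_h\<close> and read off its components. Write a
  covector \<beta> on the product as a pair (\<eta>, c), paired with (\<nu>, s) by \<nu>(\<eta>) + s
  c (\<open>blinfun_apply_cov\<close>). With \<xi> and k the two partial derivatives of h,
  \<Lambda>(dh, \<beta>) = \<mu>([\<xi>, \<eta>]) + \<mu>(\<xi>) c - k \<mu>(\<eta>). Collecting the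
  terms in \<eta> and in c shows that the vector (ad*_\<xi> \<mu> - k \<mu>, \<mu>(\<xi>))
  represents this functional of \<beta>, hence is the sharp of dh
  (\<open>sharp_LPJ_bivector\<close>). Adding h E = (0, -h) gives \<open>X_h\<close>.\<close>

lemma from_bidual_eqI:
  fixes v :: "('g::euclidean_space \<Rightarrow>\<^sub>L real) \<times> real"
  assumes "\<And>\<alpha>. \<phi> \<alpha> = blinfun_apply \<alpha> v"
  shows "from_bidual \<phi> = v"
proof -
  \<comment> \<open>\<phi> is evaluation at \<open>v\<close>, hence linear, so its representing
    vector is unique and must be \<open>v\<close>.\<close>
  have "linear \<phi>"
    by (rule linearI) (simp_all add: assms blinfun.add_left blinfun.scaleR_left)
  from linear_dual_rep_prod[OF this] show ?thesis
    unfolding from_bidual_def by (rule the1_equality) (simp add: assms)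
qed

lemma blinfun_apply_from_bidual:
  fixes \<phi> :: "('g::euclidean_space \<Rightarrow>\<^sub>L real) \<Rightarrow> real"
  assumes "linear \<phi>"
  shows "blinfun_apply \<nu> (from_bidual \<phi>) = \<phi> \<nu>"
  unfolding from_bidual_def by (rule theI'[OF linear_dual_rep[OF assms], THEN spec, symmetric])

text \<open>Makes \<open>cov_mu\<close> and \<open>cov_z\<close> coordinates on the dual of the
  product; follows by splitting (\<nu>, s) as (\<nu>, 0) + s (0, 1).\<close>

lemma blinfun_apply_cov:
  fixes \<alpha> :: "(('g::euclidean_space \<Rightarrow>\<^sub>L real) \<times> real) \<Rightarrow>\<^sub>L real"
  shows "blinfun_apply \<alpha> (\<nu>, s) = blinfun_apply \<nu> (cov_mu \<alpha>) + s * cov_z \<alpha>"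
proof -
  have "bounded_linear (\<lambda>\<nu>. blinfun_apply \<alpha> (\<nu>, 0))"
    by (intro bounded_linear_intros)
  then have "linear (\<lambda>\<nu>. blinfun_apply \<alpha> (\<nu>, 0))"
    by (rule bounded_linear.linear)
  then have "blinfun_apply \<nu> (cov_mu \<alpha>) = blinfun_apply \<alpha> (\<nu>, 0)"
    unfolding cov_mu_def by (rule blinfun_apply_from_bidual)
  moreover have "blinfun_apply \<alpha> (\<nu>, s) = blinfun_apply \<alpha> ((\<nu>, 0) + s *\<^sub>R (0, 1))"
    by simp
  ultimately show ?thesis
    by (simp only: blinfun.add_right blinfun.scaleR_right cov_z_def real_scaleR_def)
qed

lemma blinfun_apply_ad_star:
  assumes "bilinear br"
  shows "blinfun_apply (ad_star br \<xi> \<mu>) \<eta> = blinfun_apply \<mu> (br \<xi> \<eta>)"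
proof -
  \<comment> \<open>Ensures that \<open>Blinfun\<close> in \<open>ad\<close> really represents the
    bracket; linear maps are bounded in finite dimension.\<close>
  have "bounded_linear (br \<xi>)"
    using assms by (simp add: bilinear_def linear_conv_bounded_linear)
  then show ?thesis
    by (simp add: ad_star_def ad_def bounded_linear_Blinfun_apply)
qed

lemma sharp_LPJ_bivector:
  assumes "bilinear br"
  shows "sharp (LPJ_bivector br) (\<mu>, z) \<alpha> =
    (ad_star br (cov_mu \<alpha>) \<mu> - cov_z \<alpha> *\<^sub>R \<mu>, blinfun_apply \<mu> (cov_mu \<alpha>))"
  unfolding sharp_def
  by (rule from_bidual_eqI)
    (simp add: LPJ_bivector_def blinfun_apply_cov blinfun_apply_ad_star[OF assms]
      blinfun.diff_left blinfun.scaleR_left algebra_simps)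

text \<open>For \<alpha> = dh the covector components become the partial derivatives; h E only
  shifts the z-component by -h.\<close>

lemma hamiltonian_vector_field_LPJ:
  assumes "bilinear br" and "h differentiable (at (\<mu>, z))"
  shows "hamiltonian_vector_field (LPJ_bivector br) LPJ_vector h (\<mu>, z) =
    (ad_star br (delta_mu h (\<mu>, z)) \<mu> - partial_z h (\<mu>, z) *\<^sub>R \<mu>,
     blinfun_apply \<mu> (delta_mu h (\<mu>, z)) - h (\<mu>, z))"
  using assms
  by (simp add: hamiltonian_vector_field_def LPJ_vector_def sharp_LPJ_bivector
      cov_mu_differential cov_z_differential)

lemma smooth_imp_differentiable:
  assumes "smooth f"
  shows "f differentiable (at x)"
proof -
  have "Ck (Suc 0) f"
    using assms unfolding smooth_def by blast
  then show ?thesis by simp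
qed

theorem proposition5p9:
  fixes br :: "'g::euclidean_space \<Rightarrow> 'g \<Rightarrow> 'g"
    and h :: "('g \<Rightarrow>\<^sub>L real) \<times> real \<Rightarrow> real"
    and \<mu> :: "real \<Rightarrow> ('g \<Rightarrow>\<^sub>L real)"
    and z :: "real \<Rightarrow> real"
    and I :: "real set"
  assumes "lie_algebra br"
    and "smooth h"
    and "integral_curve (hamiltonian_vector_field (LPJ_bivector br) LPJ_vector h) I
           (\<lambda>t. (\<mu> t, z t))"
  shows "\<forall>t\<in>I.
      (\<mu> has_vector_derivative
         ad_star br (delta_mu h (\<mu> t, z t)) (\<mu> t) - partial_z h (\<mu> t, z t) *\<^sub>R \<mu> t) (at t)
    \<and> (z has_real_derivative
         blinfun_apply (\<mu> t) (delta_mu h (\<mu> t, z t)) - h (\<mu> t, z t)) (at t)"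
proof
  fix t assume "t \<in> I"
  have "bilinear br"
    using assms(1) by (simp add: lie_algebra_def)
  note X = hamiltonian_vector_field_LPJ[OF this smooth_imp_differentiable[OF assms(2)]]
  have D: "((\<lambda>t. (\<mu> t, z t)) has_vector_derivative
      (ad_star br (delta_mu h (\<mu> t, z t)) (\<mu> t) - partial_z h (\<mu> t, z t) *\<^sub>R \<mu> t,
       blinfun_apply (\<mu> t) (delta_mu h (\<mu> t, z t)) - h (\<mu> t, z t))) (at t)"
    using assms(3) \<open>t \<in> I\<close> by (simp add: integral_curve_def X)
  show "(\<mu> has_vector_derivative
         ad_star br (delta_mu h (\<mu> t, z t)) (\<mu> t) - partial_z h (\<mu> t, z t) *\<^sub>R \<mu> t) (at t)
    \<and> (z has_real_derivative
         blinfun_apply (\<mu> t) (delta_mu h (\<mu> t, z t)) - h (\<mu> t, z t)) (at t)"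
    \<comment> \<open>The projections are bounded linear, so they carry the derivative of the pair
      to each component.\<close>
    using bounded_linear.has_vector_derivative[OF bounded_linear_fst D]
      bounded_linear.has_vector_derivative[OF bounded_linear_snd D]
    by (simp add: has_real_derivative_iff_has_vector_derivative)
qed

end
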